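(* Let $d$ be an integer with $d\neq -3$ and let $(x,y)\in\mathbb{Z}^2$ satisfy $x^3+y^3+dxy+1=0$. Then there exists a (nonzero) integer $d_1$ dividing $d^3+27$ such that, for one choice of the sign $\pm$, $$x=\frac{3dd_1+3d_1^2\pm\sqrt{-27d^2d_1^2-18dd_1^3-3d_1^4-12(d^3+27)d_1}}{18d_1},\qquad y=\frac{d+d_1-3x}{3}.$$ *)

theory Defs
  imports Complex_Main
begin

end

theory Submission
  imports Defs
begin

text \<open>
  The factorization of \<open>a\<^sup>3 + b\<^sup>3 + c\<^sup>3 - 3abc\<close> at \<open>(a, b, c) = (3x, 3y, -d)\<close> turns the
  equation into \<open>d\<^sub>1 Q = -(d\<^sup>3 + 27)\<close> with \<open>d\<^sub>1 = 3x + 3y - d\<close>. Substituting this product into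
  the radicand makes it the perfect square \<open>(9 d\<^sub>1 (x - y))\<^sup>2\<close>.
\<close>

lemma cubic_cofactor:
  fixes d x y :: "'a::idom"
  assumes "x ^ 3 + y ^ 3 + d * x * y + 1 = 0"
  shows "d ^ 3 + 27 = (3 * x + 3 * y - d) *
    - (9 * x ^ 2 + 9 * y ^ 2 - 9 * x * y + d ^ 2 + 3 * d * x + 3 * d * y)"
  using assms by algebra

text \<open>Origin of the radicand: eliminating \<open>y\<close> by
  \<open>3 * y = d + e - 3 * x\<close> from \<open>e * Q = - (d ^ 3 + 27)\<close> leaves a quadratic
  in \<open>x\<close> with leading coefficient \<open>27 * e\<close>, whose discriminant is 9 times
  the left-hand side.\<close>

lemma radicand_eq_square:
  fixes d x y :: "'a::idom"
  assumes "x ^ 3 + y ^ 3 + d * x * y + 1 = 0" and "e = 3 * x + 3 * y - d"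
  shows "- 27 * d ^ 2 * e ^ 2 - 18 * d * e ^ 3 - 3 * e ^ 4 - 12 * (d ^ 3 + 27) * e
    = (9 * e * (x - y)) ^ 2"
  unfolding cubic_cofactor[OF assms(1)] assms(2) by algebra

lemma int_cube_eq_neg_27_iff: "d ^ 3 = - 27 \<longleftrightarrow> d = - 3" for d :: int
proof
  assume cube: "d ^ 3 = - 27"
  then have "(- d) ^ 3 = 3 ^ 3" by simp
  \<comment> \<open>Cancelling the exponent 3 is done between nonnegative bases, hence the passage
    to \<open>- d\<close>.\<close>
  moreover have "0 < - d" using cube by (smt (verit) zero_le_power)
  ultimately show "d = - 3" using power_eq_iff_eq_base[of 3 "- d" 3] by simp
qed simp

theorem theorem4p1:
  fixes d x y :: int
  assumes "d \<noteq> -3"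
    and "x ^ 3 + y ^ 3 + d * x * y + 1 = 0"
  shows "\<exists>d\<^sub>1 :: int. d\<^sub>1 \<noteq> 0 \<and> d\<^sub>1 dvd d ^ 3 + 27 \<and>
    - 27 * d ^ 2 * d\<^sub>1 ^ 2 - 18 * d * d\<^sub>1 ^ 3 - 3 * d\<^sub>1 ^ 4 - 12 * (d ^ 3 + 27) * d\<^sub>1 \<ge> 0 \<and>
    (\<exists>\<sigma> \<in> {1, -1 :: real}.
      real_of_int x =
        (real_of_int (3 * d * d\<^sub>1 + 3 * d\<^sub>1 ^ 2)
          + \<sigma> * sqrt (real_of_int
              (- 27 * d ^ 2 * d\<^sub>1 ^ 2 - 18 * d * d\<^sub>1 ^ 3 - 3 * d\<^sub>1 ^ 4 - 12 * (d ^ 3 + 27) * d\<^sub>1)))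
        / real_of_int (18 * d\<^sub>1)) \<and>
    real_of_int y = real_of_int (d + d\<^sub>1 - 3 * x) / 3"
proof -
  define e where "e = 3 * x + 3 * y - d"
  let ?D = "- 27 * d ^ 2 * e ^ 2 - 18 * d * e ^ 3 - 3 * e ^ 4 - 12 * (d ^ 3 + 27) * e"
  have dvd: "e dvd d ^ 3 + 27"
    unfolding cubic_cofactor[OF assms(2)] e_def by simp
  \<comment> \<open>If \<open>e\<close> were 0, divisibility would force
    \<open>d ^ 3 = - 27\<close>, so \<open>d = - 3\<close>.\<close>
  have nz: "e \<noteq> 0"
    using dvd assms(1) int_cube_eq_neg_27_iff[of d] by auto
  have D: "?D = (9 * e * (x - y)) ^ 2"
    by (rule radicand_eq_square[OF assms(2) e_def])
  \<comment> \<open>The square root yields only the absolute value of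
    \<open>9 * e * (x - y)\<close>; this sign undoes it.\<close>
  define \<sigma> :: real where "\<sigma> = (if e * (x - y) \<ge> 0 then 1 else - 1)"
  have "sqrt (real_of_int ?D) = \<bar>real_of_int (9 * e * (x - y))\<bar>"
    unfolding D of_int_power real_sqrt_abs ..
  then have root: "\<sigma> * sqrt (real_of_int ?D) = real_of_int (9 * e * (x - y))"
    by (simp only: \<sigma>_def) (simp add: abs_if not_le mult.assoc del: of_int_mult of_int_diff)
  \<comment> \<open>Since \<open>d + e = 3 * (x + y)\<close>, the first two terms sum to
    \<open>9 * e * (x + y)\<close>, and adding the third cancels \<open>y\<close>.\<close>
  have "18 * e * x = 3 * d * e + 3 * e ^ 2 + 9 * e * (x - y)"
    unfolding e_def by algebra
  then have "real_of_int (18 * e) * real_of_int x =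
      real_of_int (3 * d * e + 3 * e ^ 2) + \<sigma> * sqrt (real_of_int ?D)"
    unfolding root by (metis of_int_add of_int_mult)
  then have "real_of_int x =
      (real_of_int (3 * d * e + 3 * e ^ 2) + \<sigma> * sqrt (real_of_int ?D)) / real_of_int (18 * e)"
    using nz by (metis mult_eq_0_iff nonzero_mult_div_cancel_left of_int_eq_0_iff zero_neq_numeral)
  moreover have "\<sigma> \<in> {1, - 1}" by (simp add: \<sigma>_def)
  moreover have "?D \<ge> 0" unfolding D by simp
  moreover have "real_of_int y = real_of_int (d + e - 3 * x) / 3" by (simp add: e_def)
  ultimately show ?thesis using nz dvd by blast
qed

end
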